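(* For every integer $k\ge 2$ the following identities of formal power series hold: $$\sum_{\lambda \in \mathcal{P}} z^{\mu_k(\lambda)} q^{|\lambda|}\, \mathbf{y}^{\mathbf{c}_{k-1}(\lambda)} = (z;q^{k-1})_\infty \sum_{n\ge 0} \frac{z^n}{(q^{k-1};q^{k-1})_n \prod_{i=1}^{k-1} (y_i q^i; q^{k-1})_n},$$ where $\mathbf{y}=(y_1,\ldots,y_{k-1})$, and $$\sum_{\lambda \in \mathcal{D}} z^{\mu_k(\lambda)} q^{|\lambda|}\, \mathbf{y}^{\mathbf{c}_{k}(\lambda)} = (z;q^{k})_\infty \sum_{n\ge 0} \frac{\prod_{i=1}^{k} (-y_i q^i; q^{k})_n}{(q^{k};q^{k})_n}\, z^n,$$ where $\mathbf{y}=(y_1,\ldots,y_{k})$.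
   Context: A partition is a weakly decreasing sequence $\lambda=(\lambda_1,\lambda_2,\ldots)$ of nonnegative integers with finite sum $|\lambda| = \sum_i \lambda_i$; its nonzero entries are its parts, counted with multiplicity. $\mathcal{P}$ is the set of all partitions (including the empty one) and $\mathcal{D}$ is the subset of those with pairwise distinct parts. The $k$-measure $\mu_k(\lambda)$ is the maximal length $m$ of a sequence of indices $i_1<\cdots<i_m$ of parts (nonzero entries) of $\lambda$ such that $\lambda_{i_j}-\lambda_{i_{j+1}} \ge k$ for all $1\le j<m$ (so $\mu_k$ of the empty partition is $0$). For $m\ge1$, $\mathbf{c}_m(\lambda)=(c_1,\ldots,c_m)$, where $c_i$ is the number of parts of $\lambda$ congruent to $i$ modulo $m$; and $\mathbf{y}^{\mathbf{c}} = y_1^{c_1}\cdots y_m^{c_m}$. The $q$-Pochhammer symbol is $(a;q)_n = \prod_{i=0}^{n-1}(1-aq^i)$ for $n\ge 0$ (so $(a;q)_0=1$) and $(a;q)_\infty=\prod_{i\ge0}(1-aq^i)$. Here $z$, $q$ and the $y_i$ are indeterminates; all infinite sums and products are understood formally in the appropriate ring of formal power series. *)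

theory Defs
  imports
    "HOL-Computational_Algebra.Formal_Power_Series"
    "HOL-Library.Poly_Mapping"
begin

section \<open>Partitions\<close>

text \<open>The sequence is indexed from \<open>0\<close>, so \<open>lam j\<close> is \<open>\<lambda>\<^sub>j\<^sub>+\<^sub>1\<close>.  For sequences of natural
  numbers, having finite sum means having finite support.\<close>

definition partitions :: "(nat \<Rightarrow> nat) set" where
  "partitions = {lam. antimono lam \<and> finite {j. lam j \<noteq> 0}}"

definition distinct_partitions :: "(nat \<Rightarrow> nat) set" where
  "distinct_partitions = {lam \<in> partitions. inj_on lam {j. lam j \<noteq> 0}}"

definition psize :: "(nat \<Rightarrow> nat) \<Rightarrow> nat" where
  "psize lam = (\<Sum>j | lam j \<noteq> 0. lam j)"

definition gap_sequence :: "nat \<Rightarrow> (nat \<Rightarrow> nat) \<Rightarrow> nat list \<Rightarrow> bool" where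
  "gap_sequence k lam js \<longleftrightarrow>
     sorted_wrt (<) js \<and> (\<forall>j \<in> set js. lam j \<noteq> 0) \<and>
     (\<forall>i. Suc i < length js \<longrightarrow> int (lam (js ! i)) - int (lam (js ! Suc i)) \<ge> int k)"

definition k_measure :: "nat \<Rightarrow> (nat \<Rightarrow> nat) \<Rightarrow> nat" where
  "k_measure k lam = Max {length js | js. gap_sequence k lam js}"

definition part_count :: "nat \<Rightarrow> (nat \<Rightarrow> nat) \<Rightarrow> nat \<Rightarrow> nat" where
  "part_count m lam i = card {j. lam j \<noteq> 0 \<and> lam j mod m = i mod m}"

lemma finite_gap_sequence_lengths:
  assumes "lam \<in> partitions"
  shows "finite {length js | js. gap_sequence k lam js}"
proof (rule finite_subset)
  show "{length js | js. gap_sequence k lam js} \<subseteq> {..card {j. lam j \<noteq> 0}}"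
  proof
    fix l assume "l \<in> {length js | js. gap_sequence k lam js}"
    then obtain js where js: "gap_sequence k lam js" and l: "l = length js"
      by blast
    then have "distinct js"
      unfolding gap_sequence_def by (simp add: strict_sorted_iff)
    then have "length js = card (set js)"
      by (simp add: distinct_card)
    also have "\<dots> \<le> card {j. lam j \<noteq> 0}"
      using assms js by (intro card_mono) (auto simp: gap_sequence_def partitions_def)
    finally show "l \<in> {..card {j. lam j \<noteq> 0}}" using l by simp
  qed
qed simp

lemma gap_sequence_Nil: "gap_sequence k lam []"
  by (simp add: gap_sequence_def)

lemma finite_partitions_psize: "finite {lam \<in> partitions. psize lam = n}"
proof (rule finite_subset)
  let ?F = "{lam :: nat \<Rightarrow> nat. \<forall>j. (j \<in> {..<n} \<longrightarrow> lam j \<in> {..n}) \<and> (j \<notin> {..<n} \<longrightarrow> lam j = 0)}"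
  show "finite ?F"
    by (intro finite_set_of_finite_funs) auto
  show "{lam \<in> partitions. psize lam = n} \<subseteq> ?F"
  proof clarify
    fix lam j assume lam: "lam \<in> partitions" and n: "n = psize lam"
    have fin: "finite {j. lam j \<noteq> 0}" and mono: "antimono lam"
      using lam by (auto simp: partitions_def)
    have 1: "lam j \<le> psize lam"
    proof (cases "lam j = 0")
      case False
      then show ?thesis
        unfolding psize_def using fin by (intro member_le_sum) auto
    qed simp
    have 2: "lam j = 0" if "psize lam \<le> j"
    proof (rule ccontr)
      assume "lam j \<noteq> 0"
      then have pos: "lam i \<noteq> 0" if "i \<le> j" for i
        using antimonoD[OF mono that] by simp
      have "Suc j = (\<Sum>i\<le>j. 1)" by simp
      also have "\<dots> \<le> (\<Sum>i\<le>j. lam i)"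
        using pos by (intro sum_mono) (auto simp: Suc_le_eq)
      also have "\<dots> \<le> psize lam"
        unfolding psize_def using pos fin by (intro sum_mono2) auto
      finally show False using that by simp
    qed
    show "(j \<in> {..<psize lam} \<longrightarrow> lam j \<in> {..psize lam}) \<and>
          (j \<notin> {..<psize lam} \<longrightarrow> lam j = 0)"
      using 1 2 by simp
  qed
qed

section \<open>The ring of formal power series\<close>

text \<open>Power series in \<open>z\<close> whose coefficients are power series in \<open>q\<close> whose coefficients are integer
  polynomials in \<open>y\<^sub>0, y\<^sub>1, y\<^sub>2, \<dots>\<close>.  Only finitely many of the \<open>y\<^sub>i\<close> occur in any of the identities.\<close>

type_synonym qseries = "((nat \<Rightarrow>\<^sub>0 nat) \<Rightarrow>\<^sub>0 int) fps fps"

definition var_z :: qseries where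
  "var_z = fps_X"

definition var_q :: qseries where
  "var_q = fps_const fps_X"

definition var_y :: "nat \<Rightarrow> qseries" where
  "var_y i = fps_const (fps_const (Poly_Mapping.single (Poly_Mapping.single i 1) 1))"

definition y_monomial :: "nat \<Rightarrow> (nat \<Rightarrow> nat) \<Rightarrow> qseries" where
  "y_monomial m c = (\<Prod>i = 1..m. var_y i ^ c i)"

text \<open>The coefficient of \<open>z\<^sup>a q\<^sup>b\<close>.\<close>

definition zq_coeff :: "qseries \<Rightarrow> nat \<Rightarrow> nat \<Rightarrow> (nat \<Rightarrow>\<^sub>0 nat) \<Rightarrow>\<^sub>0 int" where
  "zq_coeff f a b = fps_nth (fps_nth f a) b"

text \<open>Infinite sums and products are coefficientwise.  The metric of type \<open>fps\<close> cannot be used for this: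
  on the nested type it is the \<open>z\<close>-adic one, for which \<open>(z; q)\<^sub>\<infinity>\<close> does not converge.\<close>

definition formal_summable :: "('i \<Rightarrow> qseries) \<Rightarrow> 'i set \<Rightarrow> bool" where
  "formal_summable f A \<longleftrightarrow> (\<forall>a b. finite {i \<in> A. zq_coeff (f i) a b \<noteq> 0})"

definition formal_sum :: "('i \<Rightarrow> qseries) \<Rightarrow> 'i set \<Rightarrow> qseries" where
  "formal_sum f A =
     Abs_fps (\<lambda>a. Abs_fps (\<lambda>b. \<Sum>i | i \<in> A \<and> zq_coeff (f i) a b \<noteq> 0. zq_coeff (f i) a b))"

definition has_formal_prod :: "(nat \<Rightarrow> qseries) \<Rightarrow> qseries \<Rightarrow> bool" where
  "has_formal_prod f P \<longleftrightarrow>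
     (\<forall>a b. \<forall>\<^sub>F n in sequentially. zq_coeff (\<Prod>i<n. f i) a b = zq_coeff P a b)"

definition formal_prod :: "(nat \<Rightarrow> qseries) \<Rightarrow> qseries" where
  "formal_prod f = (THE P. has_formal_prod f P)"

definition recip :: "'a::comm_ring_1 \<Rightarrow> 'a" where
  "recip u = (THE v. u * v = 1)"

definition qpoch :: "'a::comm_ring_1 \<Rightarrow> 'a \<Rightarrow> nat \<Rightarrow> 'a" where
  "qpoch a x n = (\<Prod>i<n. 1 - a * x ^ i)"

definition qpoch_inf :: "qseries \<Rightarrow> qseries \<Rightarrow> qseries" where
  "qpoch_inf a x = formal_prod (\<lambda>i. 1 - a * x ^ i)"

subsection \<open>Well-definedness\<close>

lemma qseries_eqI: "(\<And>a b. zq_coeff f a b = zq_coeff g a b) \<Longrightarrow> f = g"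
  by (simp add: fps_eq_iff zq_coeff_def)

lemma has_formal_prod_unique:
  assumes "has_formal_prod f P" "has_formal_prod f Q"
  shows "P = Q"
proof (rule qseries_eqI)
  fix a b
  have "\<forall>\<^sub>F n in sequentially. zq_coeff (\<Prod>i<n. f i) a b = zq_coeff P a b"
       "\<forall>\<^sub>F n in sequentially. zq_coeff (\<Prod>i<n. f i) a b = zq_coeff Q a b"
    using assms by (simp_all add: has_formal_prod_def)
  then have "\<forall>\<^sub>F n in sequentially. zq_coeff P a b = zq_coeff Q a b"
    by eventually_elim simp
  then show "zq_coeff P a b = zq_coeff Q a b"
    by simp
qed

lemma formal_prod_eqI: "has_formal_prod f P \<Longrightarrow> formal_prod f = P"
  unfolding formal_prod_def using has_formal_prod_unique by blast

lemma recip_eqI: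
  fixes u v :: "'a::comm_ring_1"
  assumes "u * v = 1"
  shows "recip u = v"
  unfolding recip_def
proof (rule the_equality)
  fix w assume "u * w = 1"
  then have "v * (u * w) = v" by simp
  moreover have "v * (u * w) = w"
    using assms by (simp add: mult.assoc[symmetric] mult.commute[of v u])
  ultimately show "w = v" by simp
qed (rule assms)

lemma mult_recip:
  fixes u :: "'a::comm_ring_1"
  assumes "u dvd 1"
  shows "u * recip u = 1"
  using assms recip_eqI by (metis dvdE)

lemma q_power: "var_q ^ n = fps_const (fps_X ^ n)"
  by (simp add: var_q_def)

lemma zq_coeff_q_power_mult: "zq_coeff (var_q ^ n * f) a b = (if b < n then 0 else zq_coeff f a (b - n))"
  by (simp add: zq_coeff_def q_power fps_X_power_mult_nth)

lemma zq_coeff_z_power_mult: "zq_coeff (var_z ^ n * f) a b = (if a < n then 0 else zq_coeff f (a - n) b)"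
  by (simp add: zq_coeff_def var_z_def fps_X_power_mult_nth)

lemma zq_coeff_const: "zq_coeff (fps_const (fps_const c)) a b = (if a = 0 \<and> b = 0 then c else 0)"
  by (simp add: zq_coeff_def)

lemma y_power: "var_y i ^ n = fps_const (fps_const (Poly_Mapping.single (Poly_Mapping.single i 1) 1 ^ n))"
  by (simp add: var_y_def)

lemma y_monomial_eq:
  "y_monomial m c =
     fps_const (fps_const (\<Prod>i = 1..m. Poly_Mapping.single (Poly_Mapping.single i 1) 1 ^ c i))"
  unfolding y_monomial_def y_power by (induction m) simp_all

lemma formal_summable_partitions:
  "formal_summable (\<lambda>lam. var_z ^ f lam * var_q ^ psize lam * y_monomial m (c lam)) partitions"
  unfolding formal_summable_def
proof (intro allI)
  fix a b
  show "finite {lam \<in> partitions. zq_coeff (var_z ^ f lam * var_q ^ psize lam * y_monomial m (c lam)) a b \<noteq> 0}"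
    by (rule finite_subset[OF _ finite_partitions_psize[of b]])
       (auto simp: mult.assoc zq_coeff_z_power_mult zq_coeff_q_power_mult y_monomial_eq zq_coeff_const
             split: if_splits)
qed

lemma formal_summable_subset: "formal_summable f A \<Longrightarrow> B \<subseteq> A \<Longrightarrow> formal_summable f B"
  unfolding formal_summable_def
proof (intro allI)
  fix a b
  assume *: "\<forall>a b. finite {i \<in> A. zq_coeff (f i) a b \<noteq> 0}" and "B \<subseteq> A"
  then have "{i \<in> B. zq_coeff (f i) a b \<noteq> 0} \<subseteq> {i \<in> A. zq_coeff (f i) a b \<noteq> 0}" by blast
  then show "finite {i \<in> B. zq_coeff (f i) a b \<noteq> 0}"
    using * finite_subset by blast
qed

lemma formal_summable_z_power: "formal_summable (\<lambda>n. var_z ^ n * g n) UNIV"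
  unfolding formal_summable_def
proof (intro allI)
  fix a b
  show "finite {n \<in> UNIV. zq_coeff (var_z ^ n * g n) a b \<noteq> 0}"
    by (rule finite_subset[of _ "{..a}"])
       (auto simp: zq_coeff_z_power_mult split: if_splits)
qed

lemma has_formal_prod_qpoch_inf:
  assumes "m \<ge> 1"
  shows "has_formal_prod (\<lambda>i. 1 - x * (var_q ^ m) ^ i) (qpoch_inf x (var_q ^ m))"
proof -
  let ?P = "\<lambda>n. \<Prod>i<n. 1 - x * (var_q ^ m) ^ i"
  define L where "L = Abs_fps (\<lambda>a. Abs_fps (\<lambda>b. zq_coeff (?P (Suc b)) a b))"
  have "zq_coeff (?P n) a b = zq_coeff L a b" if "n \<ge> Suc b" for n a b
    using that
  proof (induction n rule: dec_induct)
    case base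
    then show ?case by (simp add: L_def zq_coeff_def)
  next
    case (step n)
    have "b < m * n" using assms step.hyps by (metis Suc_le_eq le_trans mult_le_mono1 mult_1)
    have "?P (Suc n) = ?P n - var_q ^ (m * n) * (x * ?P n)"
      by (simp add: algebra_simps power_mult)
    then have "zq_coeff (?P (Suc n)) a b = zq_coeff (?P n) a b - zq_coeff (var_q ^ (m * n) * (x * ?P n)) a b"
      by (simp only: zq_coeff_def fps_sub_nth)
    then show ?case
      using step.IH \<open>b < m * n\<close> by (simp add: zq_coeff_q_power_mult)
  qed
  then have "has_formal_prod (\<lambda>i. 1 - x * (var_q ^ m) ^ i) L"
    unfolding has_formal_prod_def eventually_sequentially by blast
  then show ?thesis
    unfolding qpoch_inf_def using formal_prod_eqI by metis
qed

lemma dvd_one_mult: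
  fixes u v :: "'a::comm_ring_1"
  assumes "u dvd 1" "v dvd 1"
  shows "u * v dvd 1"
  using mult_dvd_mono[OF assms] by (simp only: mult_1)

lemma dvd_one_prod:
  fixes u :: "'i \<Rightarrow> 'a::comm_ring_1"
  assumes "\<And>i. i \<in> A \<Longrightarrow> u i dvd 1"
  shows "(\<Prod>i\<in>A. u i) dvd 1"
  using assms
proof (induction A rule: infinite_finite_induct)
  case (insert i A)
  then show ?case by (simp add: dvd_one_mult)
qed simp_all

lemma one_minus_q_power_dvd_one:
  assumes "n \<ge> 1"
  shows "1 - fps_const (fps_const c) * var_q ^ n dvd 1"
proof -
  define f where "f = 1 - fps_const c * fps_X ^ n"
  have "fps_nth f 0 = 1"
    using assms by (simp add: f_def)
  then have "f * fps_right_inverse f 1 = 1"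
    by (intro fps_right_inverse) simp
  then have "fps_const f * fps_const (fps_right_inverse f 1) = 1"
    by (simp only: fps_const_mult fps_const_1_eq_1)
  moreover have "1 - fps_const (fps_const c) * var_q ^ n = fps_const f"
    by (simp only: f_def q_power fps_const_mult fps_const_sub flip: fps_const_1_eq_1)
  ultimately show ?thesis
    by (metis dvd_triv_left)
qed

lemma qpoch_q_dvd_one:
  assumes "m \<ge> 1"
  shows "qpoch (var_q ^ m) (var_q ^ m) n dvd 1"
proof -
  have "1 - var_q ^ m * (var_q ^ m) ^ j dvd 1" for j
    using one_minus_q_power_dvd_one[of "m + m * j" 1] trans_le_add1[OF assms, of "m * j"]
    by (simp only: power_add power_mult fps_const_1_eq_1 mult_1)
  then show ?thesis
    unfolding qpoch_def by (intro dvd_one_prod)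
qed

lemma denominator_dvd_one:
  assumes "m \<ge> 1"
  shows "qpoch (var_q ^ m) (var_q ^ m) n * (\<Prod>i = 1..m. qpoch (var_y i * var_q ^ i) (var_q ^ m) n) dvd 1"
proof (intro dvd_one_mult qpoch_q_dvd_one dvd_one_prod assms)
  fix i assume "i \<in> {1..m}"
  then have "1 \<le> i + m * j" for j by simp
  then have "1 - var_y i * var_q ^ i * (var_q ^ m) ^ j dvd 1" for j
    using one_minus_q_power_dvd_one[of "i + m * j"]
    by (simp only: power_add power_mult var_y_def mult.assoc atLeastAtMost_iff trans_le_add1)
  then show "qpoch (var_y i * var_q ^ i) (var_q ^ m) n dvd 1"
    unfolding qpoch_def by (intro dvd_one_prod)
qed

end

theory Submission
  imports Defs
begin

text \<open>
  Both identities come from a recursion in the least admissible part.  Let \<open>d = 0\<close> for arbitrary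
  partitions and \<open>d = 1\<close> for distinct parts, choose \<open>m\<close> with \<open>k = m + 1 - d\<close>, and put \<open>Q = q\<^sup>m\<close>.  A part
  \<open>s\<close> has weight \<open>x\<^sub>s = y\<^sub>i q\<^sup>s\<close>, where \<open>i\<close> is its residue modulo \<open>m\<close>, so that \<open>x\<^sub>s\<^sub>+\<^sub>m = x\<^sub>s Q\<close>.  Let
  \<open>u\<^sub>s\<close> be \<open>1 / (1 - x\<^sub>s)\<close> or \<open>1 + x\<^sub>s\<close>, respectively, and let \<open>F\<^sub>s\<close> be the generating function of the
  partitions all of whose parts are at least \<open>s\<close>.

  The \<open>k\<close>-measure is found greedily: take the smallest part, discard all parts that exceed it by
  less than \<open>k\<close>, and repeat (\<open>k_measure_part_seq\<close>).  Distinguishing whether \<open>s\<close> is a part gives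
  (\<open>partition_series_rec\<close>)

    \<open>F\<^sub>s = F\<^sub>s\<^sub>+\<^sub>1 + z x\<^sub>s (\<Prod>s + d \<le> j < s + k. u\<^sub>j) F\<^sub>s\<^sub>+\<^sub>k\<close>.

  The series \<open>G\<^sub>s = (\<Sum>n. z\<^sup>n / (Q; Q)\<^sub>n * (\<Prod>s \<le> j < s + n m. u\<^sub>j))\<close> satisfies the same recursion
  (\<open>product_series_rec\<close>): moving the window of length \<open>n m\<close> by one changes the product by a
  multiple of \<open>x\<^sub>s - x\<^sub>s\<^sub>+\<^sub>n\<^sub>m = x\<^sub>s (1 - Q\<^sup>n)\<close>, and \<open>1 - Q\<^sup>n\<close> cancels against \<open>(Q; Q)\<^sub>n\<close>.

  Modulo \<open>q\<^sup>s\<close>, only the empty partition remains in \<open>F\<^sub>s\<close>, while \<open>G\<^sub>s\<close> becomes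
  \<open>(\<Sum>n. z\<^sup>n / (Q; Q)\<^sub>n)\<close>, which is \<open>1 / (z; Q)\<^sub>\<infinity>\<close> by Euler (\<open>euler_expansion\<close>).  As \<open>q\<^sup>s\<close> divides
  \<open>x\<^sub>s\<close>, the recursion and this limit determine the solution (\<open>recursion_unique\<close>), whence
  \<open>F\<^sub>s = (z; Q)\<^sub>\<infinity> G\<^sub>s\<close>.  For \<open>s = 1\<close> the window is \<open>{1..n m}\<close>, and sorting it by residues modulo \<open>m\<close>
  gives the stated products.
\<close>


section \<open>Formal sums\<close>

lemma zq_coeff_simps [simp]:
  "zq_coeff 0 a b = 0"
  "zq_coeff (f + g) a b = zq_coeff f a b + zq_coeff g a b"
  "zq_coeff (f - g) a b = zq_coeff f a b - zq_coeff g a b"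
  by (simp_all add: zq_coeff_def)

lemma zq_coeff_mult:
  "zq_coeff (f * g) a b = (\<Sum>i=0..a. \<Sum>j=0..b. zq_coeff f i j * zq_coeff g (a - i) (b - j))"
  by (simp add: zq_coeff_def fps_mult_nth fps_sum_nth)

lemma formal_summableD:
  "formal_summable f A \<Longrightarrow> finite {i \<in> A. zq_coeff (f i) a b \<noteq> 0}"
  by (simp add: formal_summable_def)

lemma zq_coeff_formal_sum:
  assumes "finite B" "B \<subseteq> A" "{i \<in> A. zq_coeff (f i) a b \<noteq> 0} \<subseteq> B"
  shows "zq_coeff (formal_sum f A) a b = (\<Sum>i\<in>B. zq_coeff (f i) a b)"
proof -
  have "zq_coeff (formal_sum f A) a b = (\<Sum>i | i \<in> A \<and> zq_coeff (f i) a b \<noteq> 0. zq_coeff (f i) a b)"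
    by (simp add: formal_sum_def zq_coeff_def)
  also have "\<dots> = (\<Sum>i\<in>B. zq_coeff (f i) a b)"
    using assms by (intro sum.mono_neutral_left) auto
  finally show ?thesis .
qed

lemma formal_sum_cong:
  assumes "\<And>i. i \<in> A \<Longrightarrow> f i = g i"
  shows "formal_sum f A = formal_sum g A"
proof -
  have "(\<Sum>i | i \<in> A \<and> zq_coeff (f i) a b \<noteq> 0. zq_coeff (f i) a b)
      = (\<Sum>i | i \<in> A \<and> zq_coeff (g i) a b \<noteq> 0. zq_coeff (g i) a b)" for a b
    using assms by (intro sum.cong) auto
  then show ?thesis
    by (simp add: formal_sum_def)
qed

lemma formal_sum_cmult:
  assumes "formal_summable f A"
  shows "formal_sum (\<lambda>i. c * f i) A = c * formal_sum f A"
proof (rule qseries_eqI)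
  fix a b
  define B where "B = (\<Union>p\<in>{0..a} \<times> {0..b}. {i \<in> A. zq_coeff (f i) (fst p) (snd p) \<noteq> 0})"
  have fin: "finite B"
    unfolding B_def using formal_summableD[OF assms] by blast
  have sub: "B \<subseteq> A"
    by (auto simp: B_def)
  have supp: "{i \<in> A. zq_coeff (f i) i' j' \<noteq> 0} \<subseteq> B" if "i' \<le> a" "j' \<le> b" for i' j'
    using that by (force simp: B_def)
  have "{i \<in> A. zq_coeff (c * f i) a b \<noteq> 0} \<subseteq> B"
  proof clarify
    fix i assume "i \<in> A" and nz: "zq_coeff (c * f i) a b \<noteq> 0"
    then obtain i' j' where "i' \<le> a" "j' \<le> b" "zq_coeff (f i) (a - i') (b - j') \<noteq> 0"
      unfolding zq_coeff_mult by (metis (no_types, lifting) atLeastAtMost_iff mult_zero_right sum.neutral)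
    then show "i \<in> B"
      using supp[of "a - i'" "b - j'"] \<open>i \<in> A\<close> by auto
  qed
  then have "zq_coeff (formal_sum (\<lambda>i. c * f i) A) a b = (\<Sum>i\<in>B. zq_coeff (c * f i) a b)"
    by (intro zq_coeff_formal_sum fin sub)
  also have "\<dots> = (\<Sum>i'=0..a. \<Sum>j'=0..b. zq_coeff c i' j' * (\<Sum>i\<in>B. zq_coeff (f i) (a - i') (b - j')))"
    unfolding zq_coeff_mult sum_distrib_left
    by (subst sum.swap, intro sum.cong refl, subst sum.swap) simp
  also have "\<dots> = zq_coeff (c * formal_sum f A) a b"
    unfolding zq_coeff_mult
    by (intro sum.cong refl arg_cong2[where f = "(*)"] zq_coeff_formal_sum[symmetric] fin sub supp) auto
  finally show "zq_coeff (formal_sum (\<lambda>i. c * f i) A) a b = zq_coeff (c * formal_sum f A) a b" .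
qed

lemma formal_sum_diff:
  assumes "formal_summable f A" "formal_summable g A"
  shows "formal_sum (\<lambda>i. f i - g i) A = formal_sum f A - formal_sum g A"
proof (rule qseries_eqI)
  fix a b
  define B where "B = {i \<in> A. zq_coeff (f i) a b \<noteq> 0} \<union> {i \<in> A. zq_coeff (g i) a b \<noteq> 0}"
  have B: "finite B" "B \<subseteq> A" "{i \<in> A. zq_coeff (f i) a b \<noteq> 0} \<subseteq> B"
    "{i \<in> A. zq_coeff (g i) a b \<noteq> 0} \<subseteq> B" "{i \<in> A. zq_coeff (f i - g i) a b \<noteq> 0} \<subseteq> B"
    using assms[THEN formal_summableD] by (auto simp: B_def)
  then show "zq_coeff (formal_sum (\<lambda>i. f i - g i) A) a b = zq_coeff (formal_sum f A - formal_sum g A) a b"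
    by (simp add: zq_coeff_formal_sum[of B] sum_subtractf)
qed

lemma formal_sum_Un_disjoint:
  assumes "formal_summable f (A \<union> B)" "A \<inter> B = {}"
  shows "formal_sum f (A \<union> B) = formal_sum f A + formal_sum f B"
proof (rule qseries_eqI)
  fix a b
  define S where "S C = {i \<in> C. zq_coeff (f i) a b \<noteq> 0}" for C
  have fin: "finite (S (A \<union> B))"
    using assms(1) by (simp add: S_def formal_summable_def)
  moreover have Un: "S (A \<union> B) = S A \<union> S B" "S A \<inter> S B = {}"
    using assms(2) by (auto simp: S_def)
  ultimately have "finite (S A)" "finite (S B)" by auto
  then have "(\<Sum>i\<in>S (A \<union> B). zq_coeff (f i) a b) = (\<Sum>i\<in>S A. zq_coeff (f i) a b) + (\<Sum>i\<in>S B. zq_coeff (f i) a b)"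
    unfolding Un(1) using Un(2) by (intro sum.union_disjoint)
  then show "zq_coeff (formal_sum f (A \<union> B)) a b = zq_coeff (formal_sum f A + formal_sum f B) a b"
    by (simp add: formal_sum_def zq_coeff_def S_def)
qed

lemma formal_sum_reindex:
  assumes "inj_on h A"
  shows "formal_sum f (h ` A) = formal_sum (\<lambda>i. f (h i)) A"
proof (rule qseries_eqI)
  fix a b
  have "{j. j \<in> h ` A \<and> zq_coeff (f j) a b \<noteq> 0} = h ` {i. i \<in> A \<and> zq_coeff (f (h i)) a b \<noteq> 0}"
    by auto
  moreover have "inj_on h {i. i \<in> A \<and> zq_coeff (f (h i)) a b \<noteq> 0}"
    using assms by (rule inj_on_subset) auto
  ultimately have "(\<Sum>j | j \<in> h ` A \<and> zq_coeff (f j) a b \<noteq> 0. zq_coeff (f j) a b)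
      = (\<Sum>i | i \<in> A \<and> zq_coeff (f (h i)) a b \<noteq> 0. zq_coeff (f (h i)) a b)"
    by (simp add: sum.reindex)
  then show "zq_coeff (formal_sum f (h ` A)) a b = zq_coeff (formal_sum (\<lambda>i. f (h i)) A) a b"
    by (simp add: formal_sum_def zq_coeff_def)
qed

lemma formal_sum_singleton: "formal_sum f {i} = f i"
  by (rule qseries_eqI, subst zq_coeff_formal_sum[of "{i}"]) auto

text \<open>Splits off the term \<open>n = 0\<close> and cancels a factor \<open>z\<close> from the others; this is how a factor
  \<open>1 - Q\<^sup>n\<close>, which vanishes at \<open>n = 0\<close>, turns into a factor \<open>z\<close> below.\<close>

lemma formal_sum_shift:
  "formal_sum (\<lambda>n. var_z ^ n * g n) UNIV
     = g 0 + var_z * formal_sum (\<lambda>n. var_z ^ n * g (Suc n)) UNIV"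
proof -
  have "formal_sum (\<lambda>n. var_z ^ n * g n) UNIV = formal_sum (\<lambda>n. var_z ^ n * g n) ({0} \<union> range Suc)"
    by (rule arg_cong[where f = "formal_sum _"]) (auto simp: image_iff, metis not0_implies_Suc)
  also have "\<dots> = formal_sum (\<lambda>n. var_z ^ n * g n) {0} + formal_sum (\<lambda>n. var_z ^ n * g n) (range Suc)"
    by (intro formal_sum_Un_disjoint formal_summable_subset[OF formal_summable_z_power]) auto
  also have "formal_sum (\<lambda>n. var_z ^ n * g n) (range Suc) = formal_sum (\<lambda>n. var_z * (var_z ^ n * g (Suc n))) UNIV"
    by (simp add: formal_sum_reindex mult.assoc)
  also have "\<dots> = var_z * formal_sum (\<lambda>n. var_z ^ n * g (Suc n)) UNIV"
    by (intro formal_sum_cmult formal_summable_z_power)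
  finally show ?thesis by (simp add: formal_sum_singleton)
qed

section \<open>The filtration by powers of \<open>q\<close>\<close>

lemma q_power_dvd_iff: "var_q ^ N dvd f \<longleftrightarrow> (\<forall>a b. b < N \<longrightarrow> zq_coeff f a b = 0)"
proof
  assume "var_q ^ N dvd f"
  then show "\<forall>a b. b < N \<longrightarrow> zq_coeff f a b = 0"
    by (auto simp: zq_coeff_q_power_mult elim!: dvdE)
next
  assume *: "\<forall>a b. b < N \<longrightarrow> zq_coeff f a b = 0"
  define g :: qseries where "g = Abs_fps (\<lambda>a. Abs_fps (\<lambda>b. zq_coeff f a (b + N)))"
  have "f = var_q ^ N * g"
    using * by (intro qseries_eqI) (auto simp: zq_coeff_q_power_mult, simp add: g_def zq_coeff_def)
  then show "var_q ^ N dvd f" by simp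
qed

lemma q_power_dvd_formal_sum:
  assumes "\<And>i. i \<in> A \<Longrightarrow> var_q ^ N dvd f i"
  shows "var_q ^ N dvd formal_sum f A"
  unfolding q_power_dvd_iff
proof (intro allI impI)
  fix a b assume "b < N"
  then have "zq_coeff (f i) a b = 0" if "i \<in> A" for i
    using assms[OF that] by (simp add: q_power_dvd_iff)
  then show "zq_coeff (formal_sum f A) a b = 0"
    by (subst zq_coeff_formal_sum[of "{}"]) auto
qed

lemma eq_0_if_q_power_dvd:
  assumes "\<And>N. var_q ^ N dvd f"
  shows "f = 0"
  using assms by (intro qseries_eqI) (metis lessI q_power_dvd_iff zq_coeff_simps(1))

lemma dvd_prod_minus_1:
  fixes u :: "'i \<Rightarrow> 'a::comm_ring_1"
  assumes "\<And>j. j \<in> A \<Longrightarrow> c dvd u j - 1"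
  shows "c dvd (\<Prod>j\<in>A. u j) - 1"
  using assms
proof (induction A rule: infinite_finite_induct)
  case (insert j A)
  have "(\<Prod>j\<in>insert j A. u j) - 1 = u j * ((\<Prod>j\<in>A. u j) - 1) + (u j - 1)"
    using insert.hyps by (simp add: algebra_simps)
  moreover have "c dvd u j * ((\<Prod>j\<in>A. u j) - 1)" "c dvd u j - 1"
    using insert by auto
  ultimately show ?case by (metis dvd_add)
qed simp_all

text \<open>Each use of the recursion gains a factor \<open>q\<close>: if all \<open>D s\<close> are divisible by \<open>q\<^sup>N\<close>, then
  \<open>D s \<equiv> D (s + 1) \<equiv> D (s + 2) \<equiv> \<dots>\<close> modulo \<open>q\<^sup>N\<^sup>+\<^sup>1\<close>, and the terms far out vanish modulo \<open>q\<^sup>N\<^sup>+\<^sup>1\<close>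
  because \<open>q\<^sup>s\<close> divides \<open>D s\<close>.  Applied to the difference of two
  solutions, this says that the recursion and the limit determine the solution.\<close>

lemma recursion_unique:
  assumes rec: "\<And>s. s \<ge> 1 \<Longrightarrow> D s = D (Suc s) + var_q ^ s * W s * D (s + k)"
    and lim: "\<And>s. var_q ^ s dvd D s"
    and "s \<ge> 1"
  shows "D s = (0 :: qseries)"
proof -
  have "\<forall>s\<ge>1. var_q ^ N dvd D s" for N
  proof (induction N)
    case (Suc N)
    show ?case
    proof (intro allI impI)
      fix s :: nat assume s: "s \<ge> 1"
      have step: "var_q ^ Suc N dvd D t - D (Suc t)" if "t \<ge> 1" for t
      proof -
        have "var_q ^ 1 * var_q ^ N dvd var_q ^ t * W t * D (t + k)"
          using Suc.IH that by (intro mult_dvd_mono dvd_mult2 le_imp_power_dvd) auto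
        then show ?thesis by (subst rec[OF that]) simp
      qed
      have "var_q ^ Suc N dvd D s - D (s + n)" for n
      proof (induction n)
        case (Suc n)
        have "D s - D (s + Suc n) = (D s - D (s + n)) + (D (s + n) - D (Suc (s + n)))"
          by simp
        then show ?case using Suc.IH step[of "s + n"] s by (metis dvd_add trans_le_add1)
      qed simp
      moreover have "var_q ^ Suc N dvd D (s + Suc N)"
        using lim[of "s + Suc N"] by (rule dvd_trans[rotated]) (auto intro: le_imp_power_dvd)
      ultimately have "var_q ^ Suc N dvd (D s - D (s + Suc N)) + D (s + Suc N)"
        by (intro dvd_add)
      then show "var_q ^ Suc N dvd D s" by simp
    qed
  qed simp
  then show ?thesis using \<open>s \<ge> 1\<close> by (intro eq_0_if_q_power_dvd) auto
qed

section \<open>Euler's expansion of \<open>1 / (z; Q)\<^sub>\<infinity>\<close>\<close>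

lemma recip_qpoch_Suc:
  assumes "m \<ge> 1"
  shows "recip (qpoch (var_q ^ m) (var_q ^ m) (Suc n)) * (1 - (var_q ^ m) ^ Suc n)
       = recip (qpoch (var_q ^ m) (var_q ^ m) n)"
proof -
  let ?p = "qpoch (var_q ^ m) (var_q ^ m)"
  have "?p n * (recip (?p (Suc n)) * (1 - (var_q ^ m) ^ Suc n)) = ?p (Suc n) * recip (?p (Suc n))"
    by (simp add: qpoch_def ac_simps)
  then show ?thesis
    using mult_recip[OF qpoch_q_dvd_one[OF assms]] by (metis recip_eqI)
qed

text \<open>Multiplying \<open>T N = (\<Sum>n. z\<^sup>n Q\<^sup>N\<^sup>n / (Q; Q)\<^sub>n)\<close> by \<open>1 - z Q\<^sup>N\<close> gives \<open>T (N + 1)\<close>, so the first \<open>N\<close> factors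
  of \<open>(z; Q)\<^sub>\<infinity>\<close> turn \<open>T 0\<close> into \<open>T N\<close>, which tends to its term for \<open>n = 0\<close>.\<close>

lemma euler_expansion:
  assumes "m \<ge> 1"
  shows "qpoch_inf var_z (var_q ^ m)
           * formal_sum (\<lambda>n. var_z ^ n * recip (qpoch (var_q ^ m) (var_q ^ m) n)) UNIV = 1"
proof -
  define Q where "Q = var_q ^ m"
  define r where "r n = recip (qpoch Q Q n)" for n
  define T where "T N = formal_sum (\<lambda>n. var_z ^ n * (Q ^ (N * n) * r n)) UNIV" for N
  have r: "r (Suc n) * (1 - Q ^ Suc n) = r n" for n
    unfolding r_def Q_def by (rule recip_qpoch_Suc[OF assms])
  have r0: "r 0 = 1"
    by (simp add: r_def qpoch_def recip_eqI)
  have T: "(1 - var_z * Q ^ N) * T N = T (Suc N)" for N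
  proof -
    have "T N - T (Suc N) = formal_sum (\<lambda>n. var_z ^ n * (Q ^ (N * n) * r n) - var_z ^ n * (Q ^ (Suc N * n) * r n)) UNIV"
      unfolding T_def by (intro formal_sum_diff[symmetric] formal_summable_z_power)
    also have "\<dots> = formal_sum (\<lambda>n. var_z ^ n * (Q ^ (N * n) * (r n * (1 - Q ^ n)))) UNIV"
      by (intro formal_sum_cong) (simp add: algebra_simps power_add)
    also have "\<dots> = var_z * formal_sum (\<lambda>n. Q ^ N * (var_z ^ n * (Q ^ (N * n) * r n))) UNIV"
      by (subst formal_sum_shift) (simp only: r, simp add: power_add ac_simps)
    also have "\<dots> = var_z * Q ^ N * T N"
      unfolding T_def by (subst formal_sum_cmult[OF formal_summable_z_power]) (simp add: ac_simps)
    finally show ?thesis by (simp add: algebra_simps)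
  qed
  have prod_T: "(\<Prod>i<N. 1 - var_z * Q ^ i) * T 0 = T N" for N
    by (induction N) (simp_all add: T[symmetric] ac_simps)
  have T_1: "var_q ^ N dvd T N - 1" for N
  proof -
    have "var_q ^ N dvd formal_sum (\<lambda>n. var_z ^ n * (Q ^ (N * Suc n) * r (Suc n))) UNIV"
    proof (rule q_power_dvd_formal_sum)
      fix n
      have "N \<le> m * (N * Suc n)"
        using mult_le_mono[of 1 m N "N * Suc n"] assms by simp
      then have "var_q ^ N dvd Q ^ (N * Suc n)"
        unfolding Q_def power_mult[symmetric] by (rule le_imp_power_dvd)
      then show "var_q ^ N dvd var_z ^ n * (Q ^ (N * Suc n) * r (Suc n))"
        by (intro dvd_mult dvd_mult2)
    qed
    then show ?thesis unfolding T_def by (subst formal_sum_shift) (simp add: r0)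
  qed
  have lim: "var_q ^ N dvd qpoch_inf var_z Q * T 0 - 1" for N
    unfolding q_power_dvd_iff
  proof (intro allI impI)
    fix a b assume "b < N"
    have "\<forall>\<^sub>F n in sequentially. zq_coeff (\<Prod>i<n. 1 - var_z * Q ^ i) i j = zq_coeff (qpoch_inf var_z Q) i j" for i j
      using has_formal_prod_qpoch_inf[OF assms, of var_z] unfolding has_formal_prod_def Q_def by blast
    then have "\<forall>\<^sub>F n in sequentially. \<forall>i\<in>{0..a}. \<forall>j\<in>{0..b}.
        zq_coeff (\<Prod>i<n. 1 - var_z * Q ^ i) i j = zq_coeff (qpoch_inf var_z Q) i j"
      by (intro eventually_ball_finite ballI) auto
    then obtain n0 where n0: "\<forall>n\<ge>n0. \<forall>i\<in>{0..a}. \<forall>j\<in>{0..b}.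
        zq_coeff (\<Prod>i<n. 1 - var_z * Q ^ i) i j = zq_coeff (qpoch_inf var_z Q) i j"
      unfolding eventually_sequentially by blast
    \<comment> \<open>Beyond \<open>n0\<close> the partial products agree with the infinite one as far as the coefficient sees;
      beyond \<open>N\<close> the series \<open>T n\<close> agrees with 1.\<close>
    define n where "n = n0 + N"
    have "zq_coeff (qpoch_inf var_z Q * T 0) a b = zq_coeff ((\<Prod>i<n. 1 - var_z * Q ^ i) * T 0) a b"
      unfolding zq_coeff_mult using n0 by (intro sum.cong refl) (simp add: n_def)
    moreover have "zq_coeff (T n - 1) a b = 0"
      using T_1[of n] \<open>b < N\<close> by (simp only: q_power_dvd_iff n_def trans_less_add2)
    ultimately show "zq_coeff (qpoch_inf var_z Q * T 0 - 1) a b = 0"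
      unfolding prod_T by simp
  qed
  have "qpoch_inf var_z Q * T 0 - 1 = 0"
    using lim by (rule eq_0_if_q_power_dvd)
  then show ?thesis
    by (simp add: T_def r_def Q_def)
qed


section \<open>Partitions as increasing lists\<close>

text \<open>Parts are listed from the smallest to the largest, so that \<open>Cons\<close> adds a new smallest part.
  The parameter \<open>d\<close> is the least admissible difference of neighbours: \<open>d = 0\<close> gives all
  partitions, \<open>d = 1\<close> those with distinct parts.\<close>

definition gapped_lists :: "nat \<Rightarrow> nat \<Rightarrow> nat list set" where
  "gapped_lists d s = {l. sorted_wrt (\<lambda>x y. x + d \<le> y) l \<and> (\<forall>x\<in>set l. s \<le> x)}"

text \<open>Going upwards, count the first part that is at least \<open>t\<close>, raise the threshold \<open>t\<close> to \<open>k\<close>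
  above that part, and go on.  The threshold is explicit because the weighted sums are split one
  part at a time, where parts below the threshold contribute without being counted.\<close>

fun greedy :: "nat \<Rightarrow> nat \<Rightarrow> nat list \<Rightarrow> nat" where
  "greedy k t [] = 0"
| "greedy k t (x # l) = (if t \<le> x then Suc (greedy k (x + k) l) else greedy k t l)"

text \<open>Adding a smallest part to the list leaves the indices of the other parts unchanged.\<close>

definition part_seq :: "nat list \<Rightarrow> nat \<Rightarrow> nat" where
  "part_seq l j = (if j < length l then rev l ! j else 0)"

lemma Nil_in_gapped_lists [simp]: "[] \<in> gapped_lists d s"
  by (simp add: gapped_lists_def)

lemma Cons_in_gapped_lists [simp]:
  "x # l \<in> gapped_lists d s \<longleftrightarrow> s \<le> x \<and> l \<in> gapped_lists d (x + d)"
  by (auto simp: gapped_lists_def)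

lemma gapped_lists_antimono: "s \<le> t \<Longrightarrow> gapped_lists d t \<subseteq> gapped_lists d s"
  by (force simp: gapped_lists_def)

lemma gapped_lists_split:
  "gapped_lists d s = gapped_lists d (Suc s) \<union> Cons s ` gapped_lists d (s + d)"
  (is "_ = ?R")
proof
  show "gapped_lists d s \<subseteq> ?R"
  proof
    fix l assume l: "l \<in> gapped_lists d s"
    show "l \<in> ?R"
    proof (cases l)
      case (Cons x l')
      then show ?thesis using l by (cases "x = s") auto
    qed simp
  qed
  show "?R \<subseteq> gapped_lists d s"
    using gapped_lists_antimono[of s "Suc s" d] by auto
qed

lemma gapped_lists_split_disjoint:
  "gapped_lists d (Suc s) \<inter> Cons s ` gapped_lists d (s + d) = {}"
  by auto

lemma greedy_start:
  assumes "\<forall>x\<in>set l. s \<le> x" "t \<le> s"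
  shows "greedy k t l = greedy k s l"
  using assms by (cases l) auto

lemma part_seq_Nil [simp]: "part_seq [] = (\<lambda>_. 0)"
  by (simp add: part_seq_def fun_eq_iff)

lemma part_seq_Cons: "part_seq (x # l) = (part_seq l)(length l := x)"
  by (auto simp: part_seq_def fun_eq_iff nth_append)

lemma part_seq_nonzero_iff:
  assumes "\<forall>x\<in>set l. 1 \<le> x"
  shows "part_seq l j \<noteq> 0 \<longleftrightarrow> j < length l"
proof -
  have "rev l ! j \<noteq> 0" if "j < length l"
    using assms nth_mem[of j "rev l"] that by fastforce
  then show ?thesis by (simp add: part_seq_def)
qed

lemma part_seq_ge:
  assumes "\<forall>x\<in>set l. s \<le> x" "part_seq l j \<noteq> 0"
  shows "s \<le> part_seq l j"
  using assms nth_mem[of j "rev l"] by (auto simp: part_seq_def split: if_splits)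

lemma psize_part_seq:
  assumes "\<forall>x\<in>set l. 1 \<le> x"
  shows "psize (part_seq l) = sum_list l"
proof -
  have "psize (part_seq l) = (\<Sum>j<length l. rev l ! j)"
    unfolding psize_def using part_seq_nonzero_iff[OF assms]
    by (intro sum.cong) (auto simp: part_seq_def)
  also have "\<dots> = sum_list (rev l)"
    by (simp add: sum_list_sum_nth atLeast0LessThan)
  finally show ?thesis by simp
qed

lemma part_count_part_seq_Cons:
  assumes "1 \<le> x" "\<forall>y\<in>set l. 1 \<le> y"
  shows "part_count m (part_seq (x # l)) i
       = part_count m (part_seq l) i + (if x mod m = i mod m then 1 else 0)"
proof -
  define J where "J l = {j. part_seq l j \<noteq> 0 \<and> part_seq l j mod m = i mod m}" for l
  have J: "J l \<subseteq> {..<length l}"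
    unfolding J_def using part_seq_nonzero_iff[OF assms(2)] by auto
  then have "finite (J l)" "length l \<notin> J l"
    by (auto intro: finite_subset)
  moreover have "J (x # l) = (if x mod m = i mod m then insert (length l) (J l) else J l)"
    using J assms(1) by (auto simp: J_def part_seq_Cons)
  ultimately show ?thesis
    unfolding part_count_def J_def[symmetric] by simp
qed

lemma partitions_support:
  assumes "lam \<in> partitions"
  shows "{j. lam j \<noteq> 0} = {..<card {j. lam j \<noteq> 0}}"
proof -
  have fin: "finite {j. lam j \<noteq> 0}" and mono: "antimono lam"
    using assms by (auto simp: partitions_def)
  have down: "i \<in> {j. lam j \<noteq> 0}" if "j \<in> {j. lam j \<noteq> 0}" "i \<le> j" for i j
    using that antimonoD[OF mono that(2)] by simp
  define n where "n = (LEAST n. lam n = 0)"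
  have "\<exists>n. lam n = 0"
    using fin ex_new_if_finite[OF infinite_UNIV_nat fin] by auto
  then have "lam n = 0"
    unfolding n_def by (rule LeastI_ex)
  moreover have "lam j \<noteq> 0" if "j < n" for j
    using that not_less_Least unfolding n_def by blast
  moreover have "j < n" if nz: "lam j \<noteq> 0" for j
  proof (rule ccontr)
    assume "\<not> j < n"
    then show False using down[of j n] nz \<open>lam n = 0\<close> by simp
  qed
  ultimately have "{j. lam j \<noteq> 0} = {..<n}"
    by blast
  then show ?thesis by simp
qed

lemma inj_on_part_seq: "inj_on part_seq {l. \<forall>x\<in>set l. 1 \<le> x}"
proof (rule inj_onI)
  fix l l' :: "nat list"
  assume l: "l \<in> {l. \<forall>x\<in>set l. 1 \<le> x}" and l': "l' \<in> {l. \<forall>x\<in>set l. 1 \<le> x}"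
    and eq: "part_seq l = part_seq l'"
  have "{..<length l} = {j. part_seq l j \<noteq> 0}" "{..<length l'} = {j. part_seq l' j \<noteq> 0}"
    using part_seq_nonzero_iff[of l] part_seq_nonzero_iff[of l'] l l' by auto
  then have "{..<length l} = {..<length l'}"
    by (simp only: eq)
  then have len: "length l = length l'" by (simp only: lessThan_eq_iff)
  have "rev l ! j = rev l' ! j" if "j < length (rev l)" for j
    using fun_cong[OF eq, of j] len that by (simp add: part_seq_def)
  then have "rev l = rev l'"
    using len by (intro nth_equalityI) simp_all
  then show "l = l'" by simp
qed

lemma part_seq_in_partitions:
  assumes "l \<in> gapped_lists d 1"
  shows "part_seq l \<in> partitions"
proof -
  have pos: "\<forall>x\<in>set l. 1 \<le> x" and sorted: "sorted l"
    using assms sorted_wrt_mono_rel[of l "\<lambda>x y. x + d \<le> y" "(\<le>)"]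
    by (auto simp: gapped_lists_def)
  have "part_seq l j \<le> part_seq l i" if "i \<le> j" for i j
    using that sorted by (auto simp: part_seq_def rev_nth intro: sorted_nth_mono)
  then show ?thesis
    using part_seq_nonzero_iff[OF pos] by (auto simp: partitions_def intro: antimonoI)
qed

lemma partition_list:
  assumes "lam \<in> partitions"
  defines "l \<equiv> rev (map lam [0..<card {j. lam j \<noteq> 0}])"
  shows "part_seq l = lam" "\<forall>x\<in>set l. 1 \<le> x" "sorted l"
proof -
  define n where "n = card {j. lam j \<noteq> 0}"
  have supp: "lam j \<noteq> 0 \<longleftrightarrow> j < n" for j
    using partitions_support[OF assms(1)] unfolding n_def by blast
  have l_def: "l = rev (map lam [0..<n])"
    by (simp add: assms(2) n_def)
  show "part_seq l = lam"
  proof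
    fix j
    show "part_seq l j = lam j"
      using supp[of j] by (cases "lam j = 0") (auto simp: l_def part_seq_def)
  qed
  show "\<forall>x\<in>set l. 1 \<le> x"
    using supp by (auto simp: l_def Suc_le_eq)
  have "antimono lam" using assms by (simp add: partitions_def)
  then have "sorted_wrt (\<lambda>i j. lam j \<le> lam i) [0..<n]"
    using sorted_wrt_mono_rel[OF _ sorted_upt, of 0 n "\<lambda>i j. lam j \<le> lam i"] by (simp add: antimonoD)
  then show "sorted l"
    by (simp add: l_def sorted_wrt_rev sorted_wrt_map)
qed

lemma partitions_eq: "partitions = part_seq ` gapped_lists 0 1"
proof
  show "partitions \<subseteq> part_seq ` gapped_lists 0 1"
  proof
    fix lam assume lam: "lam \<in> partitions"
    define l where "l = rev (map lam [0..<card {j. lam j \<noteq> 0}])"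
    note l = partition_list[OF lam, folded l_def]
    have "l \<in> gapped_lists 0 1"
      using l(2,3) by (simp add: gapped_lists_def)
    with l(1) show "lam \<in> part_seq ` gapped_lists 0 1" by blast
  qed
qed (use part_seq_in_partitions in blast)

lemma distinct_partitions_eq: "distinct_partitions = part_seq ` gapped_lists 1 1"
proof
  show "distinct_partitions \<subseteq> part_seq ` gapped_lists 1 1"
  proof
    fix lam assume "lam \<in> distinct_partitions"
    then have lam: "lam \<in> partitions" and inj: "inj_on lam {j. lam j \<noteq> 0}"
      by (auto simp: distinct_partitions_def)
    define l where "l = rev (map lam [0..<card {j. lam j \<noteq> 0}])"
    note l = partition_list[OF lam, folded l_def]
    have "distinct l"
      using inj partitions_support[OF lam] by (simp add: l_def distinct_map atLeast0LessThan)
    with l(3) have "sorted_wrt (<) l"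
      by (simp add: strict_sorted_iff)
    with l(2) have "l \<in> gapped_lists 1 1"
      by (simp add: gapped_lists_def Suc_le_eq)
    with l(1) show "lam \<in> part_seq ` gapped_lists 1 1" by blast
  qed
  show "part_seq ` gapped_lists 1 1 \<subseteq> distinct_partitions"
  proof clarify
    fix l assume l: "l \<in> gapped_lists 1 1"
    then have pos: "\<forall>x\<in>set l. 1 \<le> x" and "sorted_wrt (<) l"
      by (auto simp: gapped_lists_def Suc_le_eq)
    then have "distinct (rev l)" by (simp add: strict_sorted_iff)
    then have "inj_on (part_seq l) {..<length l}"
      by (auto simp: inj_on_def part_seq_def nth_eq_iff_index_eq)
    moreover have "{j. part_seq l j \<noteq> 0} = {..<length l}"
      using part_seq_nonzero_iff[OF pos] by auto
    ultimately show "part_seq l \<in> distinct_partitions"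
      using part_seq_in_partitions[OF l] by (simp add: distinct_partitions_def)
  qed
qed

section \<open>The measure is computed greedily\<close>

text \<open>Gaps of at least \<open>k\<close> between neighbours accumulate, so they may be required of all pairs.\<close>

lemma gap_sequence_iff:
  "gap_sequence k lam js \<longleftrightarrow>
     sorted_wrt (\<lambda>i j. i < j \<and> lam j + k \<le> lam i) js \<and> (\<forall>j\<in>set js. lam j \<noteq> 0)"
proof -
  have "transp (\<lambda>i j. i < j \<and> lam j + k \<le> lam i)"
    by (auto simp: transp_def)
  moreover have "transp ((<) :: nat \<Rightarrow> nat \<Rightarrow> bool)"
    by simp
  ultimately show ?thesis
    unfolding gap_sequence_def by (auto simp: sorted_wrt_iff_nth_Suc_transp)
qed

lemma gap_sequence_snoc:
  "gap_sequence k lam (js @ [j]) \<longleftrightarrow>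
     gap_sequence k lam js \<and> lam j \<noteq> 0 \<and> (\<forall>i\<in>set js. i < j \<and> lam j + k \<le> lam i)"
  by (auto simp: gap_sequence_iff sorted_wrt_append)

lemma gap_sequence_part_seq_Cons:
  assumes "length l \<notin> set js"
  shows "gap_sequence k (part_seq (x # l)) js \<longleftrightarrow> gap_sequence k (part_seq l) js"
proof -
  have eq: "part_seq (x # l) j = part_seq l j" if "j \<in> set js" for j
    using assms that by (auto simp: part_seq_Cons)
  have "sorted_wrt (\<lambda>i j. i < j \<and> part_seq (x # l) j + k \<le> part_seq (x # l) i) js
      \<longleftrightarrow> sorted_wrt (\<lambda>i j. i < j \<and> part_seq l j + k \<le> part_seq l i) js"
    by (rule iffI; erule sorted_wrt_mono_rel[rotated]) (auto simp: eq)
  then show ?thesis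
    by (simp add: gap_sequence_iff eq)
qed

text \<open>Induction on the list.  If the smallest part \<open>x\<close> reaches the threshold, the greedy count takes
  it.  Any nonempty gap sequence ends with a part that is at least \<open>x\<close>, and all its earlier parts
  are then at least \<open>x + k\<close>, so dropping its last entry leaves a sequence to which the induction
  hypothesis applies with threshold \<open>x + k\<close>.\<close>

lemma gap_sequence_le_greedy:
  assumes "l \<in> gapped_lists d s" "1 \<le> s"
    and "gap_sequence k (part_seq l) js" "\<forall>j\<in>set js. t \<le> part_seq l j"
  shows "length js \<le> greedy k t l"
  using assms
proof (induction l arbitrary: s t js)
  case Nil
  then show ?case by (cases js) (auto simp: gap_sequence_def)
next
  case (Cons x l)
  from Cons.prems have x: "s \<le> x" "1 \<le> x" and l: "l \<in> gapped_lists d x"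
    using gapped_lists_antimono[of x "x + d" d] by auto
  have all: "\<forall>y\<in>set (x # l). x \<le> y" and pos: "\<forall>y\<in>set (x # l). 1 \<le> y"
    using l x by (fastforce simp: gapped_lists_def)+
  have lt: "j \<le> length l" if "j \<in> set js" for j
    using that Cons.prems(3) part_seq_nonzero_iff[OF pos, of j] by (auto simp: gap_sequence_def)
  show ?case
  proof (cases "t \<le> x")
    case True
    show ?thesis
    proof (cases js rule: rev_cases)
      case (snoc js' j)
      have js': "gap_sequence k (part_seq (x # l)) js'" "part_seq (x # l) j \<noteq> 0"
        "\<forall>i\<in>set js'. i < j \<and> part_seq (x # l) j + k \<le> part_seq (x # l) i"
        using Cons.prems(3) by (auto simp: snoc gap_sequence_snoc)
      have "x \<le> part_seq (x # l) j"
        using part_seq_ge[OF all js'(2)] .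
      moreover have notin: "length l \<notin> set js'"
        using js'(3) lt[of j] snoc by auto
      ultimately have "\<forall>i\<in>set js'. x + k \<le> part_seq l i"
        using js'(3) by (auto simp: part_seq_Cons split: if_splits)
      moreover have "gap_sequence k (part_seq l) js'"
        using js'(1) notin by (simp add: gap_sequence_part_seq_Cons)
      ultimately have "length js' \<le> greedy k (x + k) l"
        using Cons.IH[OF l x(2)] by blast
      then show ?thesis using True by (simp add: snoc)
    qed simp
  next
    case False
    then have notin: "length l \<notin> set js"
      using Cons.prems(4) by (auto simp: part_seq_Cons)
    then have "gap_sequence k (part_seq l) js" "\<forall>j\<in>set js. t \<le> part_seq l j"
      using Cons.prems(3,4) by (auto simp: gap_sequence_part_seq_Cons, auto simp: part_seq_Cons split: if_splits)
    then show ?thesis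
      using Cons.IH[OF l x(2)] False by simp
  qed
qed

lemma greedy_attained:
  assumes "\<forall>x\<in>set l. 1 \<le> x"
  shows "\<exists>js. gap_sequence k (part_seq l) js \<and> (\<forall>j\<in>set js. t \<le> part_seq l j)
           \<and> length js = greedy k t l"
  using assms
proof (induction l arbitrary: t)
  case Nil
  then show ?case by (auto intro: exI[of _ "[]"] simp: gap_sequence_Nil)
next
  case (Cons x l)
  define t' where "t' = (if t \<le> x then x + k else t)"
  from Cons obtain js where js: "gap_sequence k (part_seq l) js"
    "\<forall>j\<in>set js. t' \<le> part_seq l j" "length js = greedy k t' l"
    by fastforce
  have lt: "j < length l" if "j \<in> set js" for j
    using that js(1) part_seq_nonzero_iff[of l j] Cons.prems by (auto simp: gap_sequence_def)
  then have notin: "length l \<notin> set js" by blast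
  have eq: "part_seq (x # l) j = part_seq l j" if "j \<in> set js" for j
    using lt[OF that] by (simp add: part_seq_Cons)
  have gs: "gap_sequence k (part_seq (x # l)) js"
    using js(1) notin by (simp add: gap_sequence_part_seq_Cons)
  show ?case
  proof (cases "t \<le> x")
    case True
    have "gap_sequence k (part_seq (x # l)) (js @ [length l])"
      unfolding gap_sequence_snoc using gs lt eq js(2) Cons.prems True
      by (auto simp: t'_def) (auto simp: part_seq_Cons)
    moreover have "\<forall>j\<in>set (js @ [length l]). t \<le> part_seq (x # l) j"
      using eq js(2) True by (auto simp: t'_def) (auto simp: part_seq_Cons)
    moreover have "length (js @ [length l]) = greedy k t (x # l)"
      using js(3) True by (simp add: t'_def)
    ultimately show ?thesis by blast
  next
    case False
    then show ?thesis using gs eq js by (auto simp: t'_def intro!: exI[of _ js])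
  qed
qed

lemma k_measure_part_seq:
  assumes "l \<in> gapped_lists d 1"
  shows "k_measure k (part_seq l) = greedy k 1 l"
  unfolding k_measure_def
proof (rule Max_eqI)
  show "finite {length js |js. gap_sequence k (part_seq l) js}"
    by (intro finite_gap_sequence_lengths part_seq_in_partitions[OF assms])
next
  fix n assume "n \<in> {length js |js. gap_sequence k (part_seq l) js}"
  then obtain js where "gap_sequence k (part_seq l) js" "n = length js" by blast
  then show "n \<le> greedy k 1 l"
    using gap_sequence_le_greedy[OF assms order_refl, of k js 1]
    by (auto simp: gap_sequence_def Suc_le_eq)
next
  show "greedy k 1 l \<in> {length js |js. gap_sequence k (part_seq l) js}"
    using greedy_attained[of l k 1] assms by (auto simp: gapped_lists_def) metis
qed

section \<open>The two recursions\<close>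

definition list_weight :: "(nat \<Rightarrow> qseries) \<Rightarrow> nat \<Rightarrow> nat \<Rightarrow> nat list \<Rightarrow> qseries" where
  "list_weight X k t l = var_z ^ greedy k t l * (\<Prod>x\<leftarrow>l. X x)"

text \<open>A part \<open>s\<close> has weight \<open>X s\<close>, and \<open>u s\<close> is the generating function of the possible multiplicities
  of \<open>s\<close>: it is \<open>1 / (1 - X s)\<close> for \<open>d = 0\<close> and \<open>1 + X s\<close> for \<open>d = 1\<close>.  The last assumption covers both.
  The identities hold for the gap \<open>k = m + 1 - d\<close>.\<close>

locale part_weights =
  fixes X u :: "nat \<Rightarrow> qseries" and m d :: nat
  assumes m: "m \<ge> 1" and d: "d \<le> 1"
    and X_dvd: "var_q ^ s dvd X s"
    and X_shift: "s \<ge> 1 \<Longrightarrow> X (s + m) = X s * var_q ^ m"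
    and u: "s \<ge> 1 \<Longrightarrow> u s = 1 + X s * (if d = 0 then u s else 1)"
begin

abbreviation k :: nat where "k \<equiv> m + 1 - d"

text \<open>All partitions with parts at least \<open>s\<close>, where only parts that are at least \<open>t\<close> are counted by
  the exponent of \<open>z\<close>.\<close>

definition partition_series :: "nat \<Rightarrow> nat \<Rightarrow> qseries" where
  "partition_series s t = formal_sum (list_weight X k t) (gapped_lists d s)"

definition Q :: qseries where "Q = var_q ^ m"

definition product_series :: "nat \<Rightarrow> qseries" where
  "product_series s =
     formal_sum (\<lambda>n. var_z ^ n * (recip (qpoch Q Q n) * (\<Prod>j=s..<s + n * m. u j))) UNIV"

definition euler_series :: qseries where
  "euler_series = formal_sum (\<lambda>n. var_z ^ n * recip (qpoch Q Q n)) UNIV"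

lemma q_power_dvd_list_weight: "var_q ^ sum_list l dvd list_weight X k t l"
proof -
  have "var_q ^ sum_list l dvd (\<Prod>x\<leftarrow>l. X x)"
    by (induction l) (auto simp: power_add intro!: mult_dvd_mono X_dvd)
  then show ?thesis by (simp add: list_weight_def)
qed

lemma summable_list_weight:
  assumes "s \<ge> 1"
  shows "formal_summable (list_weight X k t) (gapped_lists d s)"
  unfolding formal_summable_def
proof (intro allI)
  fix a b
  have "{l \<in> gapped_lists d s. zq_coeff (list_weight X k t l) a b \<noteq> 0}
      \<subseteq> {l. set l \<subseteq> {..b} \<and> length l \<le> b}"
  proof clarify
    fix l assume l: "l \<in> gapped_lists d s" "zq_coeff (list_weight X k t l) a b \<noteq> 0"
    then have le: "sum_list l \<le> b"
      using q_power_dvd_list_weight[of l t] unfolding q_power_dvd_iff by (meson linorder_not_le)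
    have "\<forall>x\<in>set l. 1 \<le> x"
      using l(1) assms by (auto simp: gapped_lists_def intro: order_trans)
    then have "length l \<le> sum_list l"
      by (induction l) auto
    with le show "set l \<subseteq> {..b} \<and> length l \<le> b"
      using member_le_sum_list[of _ l] by (force intro: order_trans)
  qed
  then show "finite {l \<in> gapped_lists d s. zq_coeff (list_weight X k t l) a b \<noteq> 0}"
    by (rule finite_subset) (rule finite_lists_length_le, simp)
qed

lemma partition_series_split:
  assumes "s \<ge> 1"
  shows "partition_series s t = partition_series (Suc s) t
           + formal_sum (\<lambda>l. list_weight X k t (s # l)) (gapped_lists d (s + d))"
proof -
  have "partition_series s t
      = formal_sum (list_weight X k t) (gapped_lists d (Suc s) \<union> Cons s ` gapped_lists d (s + d))"
    unfolding partition_series_def by (subst gapped_lists_split) simp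
  also have "\<dots> = formal_sum (list_weight X k t) (gapped_lists d (Suc s))
                + formal_sum (list_weight X k t) (Cons s ` gapped_lists d (s + d))"
    using summable_list_weight[OF assms, of t]
    by (intro formal_sum_Un_disjoint gapped_lists_split_disjoint) (subst gapped_lists_split[symmetric])
  finally show ?thesis
    by (simp add: partition_series_def formal_sum_reindex)
qed

lemma partition_series_uncounted:
  assumes "1 \<le> s" "s < t"
  shows "partition_series s t = u s * partition_series (Suc s) t"
proof -
  have "formal_sum (\<lambda>l. list_weight X k t (s # l)) (gapped_lists d (s + d))
      = formal_sum (\<lambda>l. X s * list_weight X k t l) (gapped_lists d (s + d))"
    using assms by (intro formal_sum_cong) (simp add: list_weight_def ac_simps)
  also have "\<dots> = X s * partition_series (s + d) t"
    unfolding partition_series_def using assms by (intro formal_sum_cmult summable_list_weight) simp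
  finally have rec: "partition_series s t = partition_series (Suc s) t + X s * partition_series (s + d) t"
    using partition_series_split[OF assms(1)] by simp
  show ?thesis
  proof (cases "d = 0")
    case True
    then have suc: "(1 - X s) * partition_series s t = partition_series (Suc s) t"
      and inv: "u s * (1 - X s) = 1"
      using rec u[OF assms(1)] by (simp_all add: algebra_simps)
    have "partition_series s t = u s * (1 - X s) * partition_series s t"
      by (simp only: inv mult_1)
    then show ?thesis by (simp only: mult.assoc suc)
  next
    case False
    then have "d = 1" using d by simp
    then show ?thesis using rec u[OF assms(1)] by (simp add: algebra_simps)
  qed
qed

lemma partition_series_below_start:
  assumes "1 \<le> s" "s \<le> t"
  shows "partition_series s t = (\<Prod>j=s..<t. u j) * partition_series t t"
  using assms(2,1)
proof (induction s rule: inc_induct)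
  case (step s)
  then show ?case
    by (simp add: partition_series_uncounted prod.atLeast_Suc_lessThan ac_simps)
qed simp

text \<open>Either \<open>s\<close> is not a part, or it is the first part that the greedy count takes; then the parts
  that are left below \<open>s + k\<close> are free and contribute the product.\<close>

lemma partition_series_rec:
  assumes "s \<ge> 1"
  shows "partition_series s s = partition_series (Suc s) (Suc s)
           + var_z * X s * (\<Prod>j=s + d..<s + k. u j) * partition_series (s + k) (s + k)"
proof -
  have "partition_series (Suc s) s = partition_series (Suc s) (Suc s)"
    unfolding partition_series_def
  proof (rule formal_sum_cong)
    fix l assume "l \<in> gapped_lists d (Suc s)"
    then show "list_weight X k s l = list_weight X k (Suc s) l"
      using greedy_start[of l "Suc s" s k] by (simp add: list_weight_def gapped_lists_def)
  qed
  moreover have "formal_sum (\<lambda>l. list_weight X k s (s # l)) (gapped_lists d (s + d))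
      = formal_sum (\<lambda>l. var_z * X s * list_weight X k (s + k) l) (gapped_lists d (s + d))"
    by (intro formal_sum_cong) (simp add: list_weight_def ac_simps)
  moreover have "\<dots> = var_z * X s * partition_series (s + d) (s + k)"
    unfolding partition_series_def using assms by (intro formal_sum_cmult summable_list_weight) simp
  moreover have "partition_series (s + d) (s + k)
      = (\<Prod>j=s + d..<s + k. u j) * partition_series (s + k) (s + k)"
    using assms m d by (intro partition_series_below_start) auto
  ultimately show ?thesis
    using partition_series_split[OF assms, of s] by (simp add: mult.assoc)
qed

lemma partition_series_limit: "var_q ^ s dvd partition_series s s - 1"
proof (cases "s = 0")
  case False
  define A where "A = gapped_lists d s - {[]}"
  have split: "gapped_lists d s = {[]} \<union> A" "{[]} \<inter> A = {}"
    by (auto simp: A_def)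
  have "partition_series s s = formal_sum (list_weight X k s) {[]} + formal_sum (list_weight X k s) A"
    unfolding partition_series_def split(1) using summable_list_weight[of s s] False split
    by (intro formal_sum_Un_disjoint) (simp_all flip: split(1))
  then have "partition_series s s - 1 = formal_sum (list_weight X k s) A"
    by (simp add: formal_sum_singleton list_weight_def)
  moreover have "var_q ^ s dvd list_weight X k s l" if l: "l \<in> A" for l
  proof -
    obtain x l' where "l = x # l'" "s \<le> x"
      using l by (cases l) (auto simp: A_def)
    then have "s \<le> sum_list l" by simp
    then show ?thesis
      using q_power_dvd_list_weight by (meson dvd_trans le_imp_power_dvd)
  qed
  ultimately show ?thesis
    by (simp add: q_power_dvd_formal_sum)
qed simp

lemma X_shift_mult: "s \<ge> 1 \<Longrightarrow> X (s + n * m) = X s * Q ^ n"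
proof (induction n)
  case (Suc n)
  have "X (s + Suc n * m) = X (s + n * m + m)"
    by (simp add: ac_simps)
  then show ?case
    using Suc X_shift[of "s + n * m"] by (simp add: Q_def ac_simps)
qed simp

text \<open>The two windows share all factors but the outermost ones, which differ only by
  \<open>X s - X (s + N) = X s * (1 - Q\<^sup>n\<^sup>+\<^sup>1)\<close> with \<open>N = (n + 1) m\<close> once a common product is taken out.  For
  \<open>d = 0\<close> this is the product over the union of the windows, for \<open>d = 1\<close> over their
  intersection; so it is only for \<open>k = m + 1 - d\<close> that what is left after the first \<open>k\<close> positions
  is exactly a window of length \<open>n m\<close>.\<close>

lemma window_difference:
  assumes "s \<ge> 1"
  shows "(\<Prod>j=s..<s + Suc n * m. u j) - (\<Prod>j=Suc s..<Suc s + Suc n * m. u j)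
       = (1 - Q ^ Suc n) * (X s * (\<Prod>j=s + d..<s + k. u j) * (\<Prod>j=s + k..<s + k + n * m. u j))"
proof -
  define N where "N = Suc n * m"
  have N: "N \<ge> 1" using m by (simp add: N_def)
  have Xs: "X (s + N) = X s * Q ^ Suc n"
    unfolding N_def by (rule X_shift_mult[OF assms])
  have "s + k + n * m = s + N + 1 - d" "s + d \<le> s + k"
    using d m by (auto simp: N_def)
  then have mid: "(\<Prod>j=s + d..<s + k. u j) * (\<Prod>j=s + k..<s + k + n * m. u j)
      = (\<Prod>j=s + d..<s + N + 1 - d. u j)"
    by (subst prod.atLeastLessThan_concat) auto
  have "(\<Prod>j=s..<s + N. u j) - (\<Prod>j=Suc s..<Suc s + N. u j)
      = (1 - Q ^ Suc n) * (X s * (\<Prod>j=s + d..<s + N + 1 - d. u j))"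
  proof (cases "d = 0")
    case True
    define T where "T = (\<Prod>j=s..<s + N + 1. u j)"
    have T: "T = (\<Prod>j=s..<s + N. u j) * u (s + N)" "T = u s * (\<Prod>j=Suc s..<Suc s + N. u j)"
      by (simp_all add: T_def prod.atLeast_Suc_lessThan)
    have inv: "u s * (1 - X s) = 1" "u (s + N) * (1 - X (s + N)) = 1"
      using u[of s] u[of "s + N"] assms True by (simp_all add: algebra_simps)
    have "(\<Prod>j=s..<s + N. u j) = T * (1 - X (s + N))"
      unfolding T(1) by (simp only: mult.assoc inv(2) mult_1_right)
    moreover have "(\<Prod>j=Suc s..<Suc s + N. u j) = T * (1 - X s)"
    proof -
      have "T * (1 - X s) = u s * (1 - X s) * (\<Prod>j=Suc s..<Suc s + N. u j)"
        unfolding T(2) by (simp only: ac_simps)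
      then show ?thesis by (simp only: inv(1) mult_1)
    qed
    moreover have "(\<Prod>j=s + d..<s + N + 1 - d. u j) = T"
      using True by (simp add: T_def)
    ultimately show ?thesis
      unfolding Xs by (simp only: algebra_simps mult_1)
  next
    case False
    then have "d = 1" using d by simp
    define T where "T = (\<Prod>j=Suc s..<s + N. u j)"
    have "(\<Prod>j=s..<s + N. u j) = T * (1 + X s)"
      using u[OF assms] N \<open>d = 1\<close> by (simp add: T_def prod.atLeast_Suc_lessThan mult.commute)
    moreover have "(\<Prod>j=Suc s..<Suc s + N. u j) = T * (1 + X (s + N))"
      using u[of "s + N"] assms N \<open>d = 1\<close> by (simp add: T_def)
    moreover have "(\<Prod>j=s + d..<s + N + 1 - d. u j) = T"
      using \<open>d = 1\<close> by (simp add: T_def)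
    ultimately show ?thesis
      unfolding Xs by (simp only: algebra_simps mult_1 mult_1_right)
  qed
  then show ?thesis
    unfolding N_def[symmetric] mid[symmetric] by (simp add: mult.assoc)
qed

text \<open>The factor \<open>1 - Q\<^sup>n\<close> of the window difference cancels the last factor of \<open>(Q; Q)\<^sub>n\<close>, which
  leaves the series for \<open>s + k\<close> with the index shifted by one.\<close>

lemma product_series_rec:
  assumes "s \<ge> 1"
  shows "product_series s = product_series (Suc s)
           + var_z * X s * (\<Prod>j=s + d..<s + k. u j) * product_series (s + k)"
proof -
  define r where "r n = recip (qpoch Q Q n)" for n
  define P where "P s n = (\<Prod>j=s..<s + n * m. u j)" for s n
  define G where "G = X s * (\<Prod>j=s + d..<s + k. u j)"
  have r: "r (Suc n) * (1 - Q ^ Suc n) = r n" for n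
    unfolding r_def Q_def by (rule recip_qpoch_Suc[OF m])
  have S: "product_series s = formal_sum (\<lambda>n. var_z ^ n * (r n * P s n)) UNIV" for s
    by (simp add: product_series_def r_def P_def)
  have diff: "r (Suc n) * P s (Suc n) - r (Suc n) * P (Suc s) (Suc n) = G * (r n * P (s + k) n)" for n
  proof -
    have "r (Suc n) * P s (Suc n) - r (Suc n) * P (Suc s) (Suc n)
        = r (Suc n) * ((1 - Q ^ Suc n) * (G * P (s + k) n))"
      unfolding P_def G_def window_difference[OF assms, symmetric] by (simp only: right_diff_distrib)
    also have "\<dots> = r (Suc n) * (1 - Q ^ Suc n) * (G * P (s + k) n)"
      by (simp only: mult.assoc)
    finally show ?thesis
      unfolding r by (simp only: mult.left_commute)
  qed
  have "product_series s - product_series (Suc s)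
      = formal_sum (\<lambda>n. var_z ^ n * (r n * P s n) - var_z ^ n * (r n * P (Suc s) n)) UNIV"
    unfolding S by (intro formal_sum_diff[symmetric] formal_summable_z_power)
  also have "\<dots> = formal_sum (\<lambda>n. var_z ^ n * (r n * P s n - r n * P (Suc s) n)) UNIV"
    by (intro formal_sum_cong) (simp add: right_diff_distrib)
  also have "\<dots> = var_z * formal_sum (\<lambda>n. G * (var_z ^ n * (r n * P (s + k) n))) UNIV"
    by (subst formal_sum_shift) (simp only: diff, simp add: P_def ac_simps)
  also have "\<dots> = var_z * (G * product_series (s + k))"
    unfolding S by (subst formal_sum_cmult[OF formal_summable_z_power]) (rule refl)
  finally show ?thesis
    by (simp add: G_def algebra_simps)
qed

lemma product_series_limit: "var_q ^ s dvd product_series s - euler_series"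
proof (cases "s = 0")
  case False
  define r where "r n = recip (qpoch Q Q n)" for n
  define P where "P n = (\<Prod>j=s..<s + n * m. u j)" for n
  have P: "var_q ^ s dvd P n - 1" for n
    unfolding P_def
  proof (rule dvd_prod_minus_1)
    fix j assume "j \<in> {s..<s + n * m}"
    then have j: "s \<le> j" "1 \<le> j" using False by auto
    have "var_q ^ s dvd X j"
      using X_dvd[of j] le_imp_power_dvd[OF j(1), of var_q] by (rule dvd_trans[rotated])
    then show "var_q ^ s dvd u j - 1"
      by (subst u[OF j(2)]) simp
  qed
  have "product_series s - euler_series
      = formal_sum (\<lambda>n. var_z ^ n * (r n * P n) - var_z ^ n * r n) UNIV"
    unfolding product_series_def euler_series_def r_def P_def
    by (intro formal_sum_diff[symmetric] formal_summable_z_power)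
  also have "\<dots> = formal_sum (\<lambda>n. var_z ^ n * r n * (P n - 1)) UNIV"
    by (intro formal_sum_cong) (simp add: algebra_simps)
  finally show ?thesis
    using P by (simp add: q_power_dvd_formal_sum)
qed simp

lemma product_series_eq:
  assumes "s \<ge> 1"
  shows "product_series s = euler_series * partition_series s s"
proof -
  define D where "D s = product_series s - euler_series * partition_series s s" for s
  \<comment> \<open>\<open>W s\<close> is the coefficient of the recursions with the factor \<open>q\<^sup>s\<close> of \<open>X s\<close> taken out.\<close>
  define W where "W s = var_z * (SOME v. X s = var_q ^ s * v) * (\<Prod>j=s + d..<s + k. u j)" for s
  have W: "var_z * X s * (\<Prod>j=s + d..<s + k. u j) = var_q ^ s * W s" for s
  proof -
    have "X s = var_q ^ s * (SOME v. X s = var_q ^ s * v)"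
      using X_dvd[of s] unfolding dvd_def by (rule someI_ex)
    then have "var_z * X s = var_q ^ s * (var_z * (SOME v. X s = var_q ^ s * v))"
      by (metis mult.left_commute)
    then show ?thesis by (simp only: W_def mult.assoc)
  qed
  have "D s = 0"
  proof (rule recursion_unique)
    fix s :: nat assume s: "s \<ge> 1"
    show "D s = D (Suc s) + var_q ^ s * W s * D (s + k)"
      using product_series_rec[OF s] partition_series_rec[OF s] unfolding D_def W
      by (simp add: algebra_simps)
  next
    fix s
    have "D s = (product_series s - euler_series) - euler_series * (partition_series s s - 1)"
      by (simp add: D_def algebra_simps)
    then show "var_q ^ s dvd D s"
      using product_series_limit partition_series_limit by simp
  qed (rule assms)
  then show ?thesis by (simp add: D_def)
qed

lemma partition_series_eq:
  "partition_series 1 1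
     = qpoch_inf var_z (var_q ^ m)
       * formal_sum (\<lambda>n. var_z ^ n * (recip (qpoch (var_q ^ m) (var_q ^ m) n) * (\<Prod>j=1..<1 + n * m. u j))) UNIV"
proof -
  have "qpoch_inf var_z Q * product_series 1 = (qpoch_inf var_z Q * euler_series) * partition_series 1 1"
    by (simp add: product_series_eq mult.assoc)
  also have "qpoch_inf var_z Q * euler_series = 1"
    unfolding euler_series_def Q_def by (rule euler_expansion[OF m])
  finally show ?thesis
    by (simp add: product_series_def Q_def)
qed

end

section \<open>Coloured weights of partitions\<close>

text \<open>The index \<open>Suc ((s - 1) mod m)\<close> is the representative of \<open>s\<close> modulo \<open>m\<close> in \<open>{1..m}\<close>.\<close>

definition part_var :: "nat \<Rightarrow> nat \<Rightarrow> qseries" where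
  "part_var m s = var_y (Suc ((s - 1) mod m)) * var_q ^ s"

lemma part_var_residue:
  assumes "i \<in> {1..m}"
  shows "part_var m (i + m * j) = var_y i * var_q ^ i * (var_q ^ m) ^ j"
proof -
  obtain i' where "i = Suc i'" "i' < m"
    using assms by (cases i) auto
  then show ?thesis
    by (simp add: part_var_def power_add power_mult mult.assoc)
qed

lemma residue_representative:
  assumes "1 \<le> x" "i \<in> {1..m}"
  shows "x mod m = i mod m \<longleftrightarrow> i = Suc ((x - 1) mod m)"
proof -
  obtain x' i' where x': "x = Suc x'" and i': "i = Suc i'" "i' < m"
    using assms by (cases x; cases i) auto
  have "x' mod m < m" using i' by simp
  then show ?thesis
    using i' by (auto simp: x' mod_Suc)
qed

text \<open>The \<open>q\<close>- and \<open>y\<close>-weights of a partition are multiplicative over its parts.\<close>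

lemma partition_weight_part_seq:
  assumes "m \<ge> 1" "\<forall>x\<in>set l. 1 \<le> x"
  shows "var_q ^ psize (part_seq l) * y_monomial m (part_count m (part_seq l)) = (\<Prod>x\<leftarrow>l. part_var m x)"
proof -
  have "y_monomial m (part_count m (part_seq l)) = (\<Prod>x\<leftarrow>l. var_y (Suc ((x - 1) mod m)))"
    using assms(2)
  proof (induction l)
    case Nil
    then show ?case by (simp add: y_monomial_def part_count_def)
  next
    case (Cons x l)
    define r where "r = Suc ((x - 1) mod m)"
    have r: "r \<in> {1..m}"
      using assms(1) by (simp add: r_def Suc_le_eq)
    have "y_monomial m (part_count m (part_seq (x # l)))
        = (\<Prod>i=1..m. var_y i ^ part_count m (part_seq l) i * (if i = r then var_y i else 1))"
      unfolding y_monomial_def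
    proof (intro prod.cong refl)
      fix i assume "i \<in> {1..m}"
      then show "var_y i ^ part_count m (part_seq (x # l)) i
          = var_y i ^ part_count m (part_seq l) i * (if i = r then var_y i else 1)"
        using residue_representative[of x i m, folded r_def] part_count_part_seq_Cons[of x l m i] Cons.prems
        by simp
    qed
    also have "\<dots> = y_monomial m (part_count m (part_seq l)) * var_y r"
      unfolding prod.distrib y_monomial_def using r by (simp add: prod.delta)
    finally show ?case
      using Cons by (simp add: r_def ac_simps)
  qed
  moreover have "(\<Prod>x\<leftarrow>l. part_var m x) = var_q ^ sum_list l * (\<Prod>x\<leftarrow>l. var_y (Suc ((x - 1) mod m)))"
    by (induction l) (simp_all add: part_var_def power_add ac_simps)
  ultimately show ?thesis
    by (simp add: psize_part_seq[OF assms(2)])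
qed

lemma partition_sum_eq_list_sum:
  assumes "m \<ge> 1"
  shows "formal_sum (\<lambda>lam. var_z ^ k_measure k lam * var_q ^ psize lam * y_monomial m (part_count m lam))
           (part_seq ` gapped_lists d 1)
       = formal_sum (list_weight (part_var m) k 1) (gapped_lists d 1)"
proof -
  have pos: "\<forall>x\<in>set l. 1 \<le> x" if "l \<in> gapped_lists d 1" for l
    using that by (simp add: gapped_lists_def)
  then have "inj_on part_seq (gapped_lists d 1)"
    by (intro inj_on_subset[OF inj_on_part_seq]) auto
  then show ?thesis
    using pos assms
    by (simp add: formal_sum_reindex)
       (intro formal_sum_cong, simp add: k_measure_part_seq list_weight_def mult.assoc partition_weight_part_seq)
qed

text \<open>Sorting \<open>{1..n m}\<close> by residues turns a product of \<open>m\<close> Pochhammer symbols into a single window.\<close>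

lemma prod_residue_classes:
  fixes g :: "nat \<Rightarrow> 'a::comm_monoid_mult"
  shows "(\<Prod>j=1..<1 + n * m. g j) = (\<Prod>i=1..m. \<Prod>j<n. g (i + m * j))"
proof (induction n)
  case (Suc n)
  have "(\<Prod>j=1..<1 + Suc n * m. g j) = (\<Prod>j=1..<1 + n * m. g j) * (\<Prod>j=1 + n * m..<1 + Suc n * m. g j)"
    by (rule prod.atLeastLessThan_concat[symmetric]) auto
  also have "(\<Prod>j=1 + n * m..<1 + Suc n * m. g j) = (\<Prod>i=1..m. g (i + m * n))"
    by (rule prod.reindex_bij_witness[of _ "\<lambda>i. i + m * n" "\<lambda>j. j - m * n"]) (auto simp: ac_simps)
  finally show ?case
    by (simp only: Suc.IH prod.lessThan_Suc prod.distrib)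
qed simp

lemma recip_mult:
  fixes a b :: "'a::comm_ring_1"
  assumes "a dvd 1" "b dvd 1"
  shows "recip (a * b) = recip a * recip b"
proof (rule recip_eqI)
  have "a * b * (recip a * recip b) = (a * recip a) * (b * recip b)"
    by (simp only: ac_simps)
  then show "a * b * (recip a * recip b) = 1"
    by (simp only: mult_recip assms mult_1)
qed

lemma recip_prod:
  fixes f :: "'i \<Rightarrow> 'a::comm_ring_1"
  assumes "\<And>i. i \<in> A \<Longrightarrow> f i dvd 1"
  shows "recip (\<Prod>i\<in>A. f i) = (\<Prod>i\<in>A. recip (f i))"
  by (rule recip_eqI) (simp add: prod.distrib[symmetric] mult_recip assms)

lemma one_minus_part_var_dvd_one: "s \<ge> 1 \<Longrightarrow> 1 - part_var m s dvd 1"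
  unfolding part_var_def var_y_def by (rule one_minus_q_power_dvd_one)

lemma part_var_shift: "s \<ge> 1 \<Longrightarrow> part_var m (s + m) = part_var m s * var_q ^ m"
  by (cases s) (simp_all add: part_var_def power_add ac_simps)

lemma partitions_product_formula:
  assumes "m \<ge> 1"
  shows "formal_sum (\<lambda>lam. var_z ^ k_measure (m + 1) lam * var_q ^ psize lam
             * y_monomial m (part_count m lam)) partitions
         = qpoch_inf var_z (var_q ^ m)
           * formal_sum (\<lambda>n. var_z ^ n * recip (qpoch (var_q ^ m) (var_q ^ m) n
               * (\<Prod>i = 1..m. qpoch (var_y i * var_q ^ i) (var_q ^ m) n))) UNIV"
proof -
  interpret part_weights "part_var m" "\<lambda>s. recip (1 - part_var m s)" m 0
  proof
    fix s :: nat assume "s \<ge> 1"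
    then have "(1 - part_var m s) * recip (1 - part_var m s) = 1"
      by (intro mult_recip one_minus_part_var_dvd_one)
    then show "recip (1 - part_var m s)
        = 1 + part_var m s * (if (0::nat) = 0 then recip (1 - part_var m s) else 1)"
      by (simp add: algebra_simps)
  qed (use assms part_var_shift in \<open>auto simp: part_var_def\<close>)
  have "recip (qpoch (var_q ^ m) (var_q ^ m) n) * (\<Prod>j=1..<1 + n * m. recip (1 - part_var m j))
      = recip (qpoch (var_q ^ m) (var_q ^ m) n * (\<Prod>i=1..m. qpoch (var_y i * var_q ^ i) (var_q ^ m) n))" for n
  proof -
    have unit: "(\<Prod>j=1..<1 + n * m. 1 - part_var m j) dvd 1"
      by (intro dvd_one_prod one_minus_part_var_dvd_one) simp
    have "(\<Prod>i=1..m. qpoch (var_y i * var_q ^ i) (var_q ^ m) n) = (\<Prod>j=1..<1 + n * m. 1 - part_var m j)"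
      unfolding prod_residue_classes qpoch_def by (intro prod.cong refl) (simp add: part_var_residue)
    moreover have "recip (\<Prod>j=1..<1 + n * m. 1 - part_var m j) = (\<Prod>j=1..<1 + n * m. recip (1 - part_var m j))"
      by (intro recip_prod one_minus_part_var_dvd_one) simp
    ultimately show ?thesis
      using recip_mult[OF qpoch_q_dvd_one[OF assms] unit, of n] by simp
  qed
  then show ?thesis
    using partition_series_eq partition_sum_eq_list_sum[OF assms, of "m + 1" 0]
    by (simp add: partition_series_def partitions_eq)
qed

lemma distinct_partitions_product_formula:
  assumes "m \<ge> 1"
  shows "formal_sum (\<lambda>lam. var_z ^ k_measure m lam * var_q ^ psize lam
             * y_monomial m (part_count m lam)) distinct_partitions
         = qpoch_inf var_z (var_q ^ m)
           * formal_sum (\<lambda>n. var_z ^ n * ((\<Prod>i = 1..m. qpoch (- var_y i * var_q ^ i) (var_q ^ m) n)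
               * recip (qpoch (var_q ^ m) (var_q ^ m) n))) UNIV"
proof -
  interpret part_weights "part_var m" "\<lambda>s. 1 + part_var m s" m 1
    by unfold_locales (use assms part_var_shift in \<open>auto simp: part_var_def\<close>)
  have "(\<Prod>i=1..m. qpoch (- var_y i * var_q ^ i) (var_q ^ m) n) = (\<Prod>j=1..<1 + n * m. 1 + part_var m j)" for n
    unfolding prod_residue_classes qpoch_def by (intro prod.cong refl) (simp add: part_var_residue)
  then show ?thesis
    using partition_series_eq partition_sum_eq_list_sum[OF assms, of m 1]
    unfolding partition_series_def distinct_partitions_eq by (simp add: mult.commute)
qed

theorem theorem1p9:
  fixes k :: nat
  assumes "k \<ge> 2"
  shows "formal_sum (\<lambda>lam. var_z ^ k_measure k lam * var_q ^ psize lam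
             * y_monomial (k - 1) (part_count (k - 1) lam)) partitions
         = qpoch_inf var_z (var_q ^ (k - 1))
           * formal_sum (\<lambda>n. var_z ^ n * recip (qpoch (var_q ^ (k - 1)) (var_q ^ (k - 1)) n
               * (\<Prod>i = 1..k - 1. qpoch (var_y i * var_q ^ i) (var_q ^ (k - 1)) n))) UNIV
       \<and> formal_sum (\<lambda>lam. var_z ^ k_measure k lam * var_q ^ psize lam
             * y_monomial k (part_count k lam)) distinct_partitions
         = qpoch_inf var_z (var_q ^ k)
           * formal_sum (\<lambda>n. var_z ^ n * ((\<Prod>i = 1..k. qpoch (- var_y i * var_q ^ i) (var_q ^ k) n)
               * recip (qpoch (var_q ^ k) (var_q ^ k) n))) UNIV"
proof
  have "k - 1 \<ge> 1" "k - 1 + 1 = k" "k \<ge> 1"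
    using assms by auto
  then show "formal_sum (\<lambda>lam. var_z ^ k_measure k lam * var_q ^ psize lam
             * y_monomial (k - 1) (part_count (k - 1) lam)) partitions
         = qpoch_inf var_z (var_q ^ (k - 1))
           * formal_sum (\<lambda>n. var_z ^ n * recip (qpoch (var_q ^ (k - 1)) (var_q ^ (k - 1)) n
               * (\<Prod>i = 1..k - 1. qpoch (var_y i * var_q ^ i) (var_q ^ (k - 1)) n))) UNIV"
    and "formal_sum (\<lambda>lam. var_z ^ k_measure k lam * var_q ^ psize lam
             * y_monomial k (part_count k lam)) distinct_partitions
         = qpoch_inf var_z (var_q ^ k)
           * formal_sum (\<lambda>n. var_z ^ n * ((\<Prod>i = 1..k. qpoch (- var_y i * var_q ^ i) (var_q ^ k) n)
               * recip (qpoch (var_q ^ k) (var_q ^ k) n))) UNIV"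
    using partitions_product_formula[of "k - 1"] distinct_partitions_product_formula[of k] by simp_all
qed

end
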